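(* Let $\mathcal{B}$ be a finite connected undirected graph with $\beta(\mathcal{B})\geq 2$. Then the total number of pivot vertices in $\mathcal{B}$ is at most $3(\beta(\mathcal{B})-1)$.
   Context: A finite undirected graph $\mathcal{B}$ has a finite vertex set $\mathcal{V}$ and an edge set $\mathcal{E}$ of $2$-element subsets of $\mathcal{V}$. For a group $G$ acting on $\mathcal{B}$ by graph automorphisms, a vertex $v$ is a $G$-pivot vertex if for every $w\in\mathcal{V}$ with $\{v,w\}\in\mathcal{E}$, the set $\{gw\mid g\in G,\ gv=v\}$ has even cardinality; a pivot vertex of $\mathcal{B}$ is a $G$-pivot vertex for $G=\mathrm{Aut}(\mathcal{B})$. The Betti number is $\beta(\mathcal{B})=|\mathcal{E}|-|\mathcal{V}|+1$. *)

theory Defs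
  imports "HOL-Algebra.Group_Action"
begin

definition finite_graph :: "'a set \<Rightarrow> 'a set set \<Rightarrow> bool" where
  "finite_graph V E \<longleftrightarrow> finite V \<and> (\<forall>e\<in>E. e \<subseteq> V \<and> card e = 2)"

definition connected_graph :: "'a set \<Rightarrow> 'a set set \<Rightarrow> bool" where
  "connected_graph V E \<longleftrightarrow>
     V \<noteq> {} \<and> (\<forall>u\<in>V. \<forall>w\<in>V. (\<lambda>x y. {x, y} \<in> E)\<^sup>*\<^sup>* u w)"

definition betti :: "'a set \<Rightarrow> 'a set set \<Rightarrow> int" where
  "betti V E = int (card E) - int (card V) + 1"

definition graph_automorphisms :: "'a set \<Rightarrow> 'a set set \<Rightarrow> ('a \<Rightarrow> 'a) set" where
  "graph_automorphisms V E =
     {f \<in> Bij V. \<forall>x\<in>V. \<forall>y\<in>V. {f x, f y} \<in> E \<longleftrightarrow> {x, y} \<in> E}"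

definition Aut_graph :: "'a set \<Rightarrow> 'a set set \<Rightarrow> ('a \<Rightarrow> 'a) monoid" where
  "Aut_graph V E = (BijGroup V)\<lparr>carrier := graph_automorphisms V E\<rparr>"

definition graph_action ::
  "'a set \<Rightarrow> 'a set set \<Rightarrow> ('g, 'm) monoid_scheme \<Rightarrow> ('g \<Rightarrow> 'a \<Rightarrow> 'a) \<Rightarrow> bool" where
  "graph_action V E G \<phi> \<longleftrightarrow>
     group_action G V \<phi> \<and> \<phi> ` carrier G \<subseteq> graph_automorphisms V E"

definition G_pivot_vertex ::
  "'a set \<Rightarrow> 'a set set \<Rightarrow> ('g, 'm) monoid_scheme \<Rightarrow> ('g \<Rightarrow> 'a \<Rightarrow> 'a) \<Rightarrow> 'a \<Rightarrow> bool" where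
  "G_pivot_vertex V E G \<phi> v \<longleftrightarrow>
     v \<in> V \<and> (\<forall>w\<in>V. {v, w} \<in> E \<longrightarrow> even (card {\<phi> g w | g. g \<in> stabilizer G \<phi> v}))"

text \<open>The automorphism group acts tautologically, that is, by the identity homomorphism.\<close>

definition pivot_vertex :: "'a set \<Rightarrow> 'a set set \<Rightarrow> 'a \<Rightarrow> bool" where
  "pivot_vertex V E = G_pivot_vertex V E (Aut_graph V E) (\<lambda>f. f)"

lemma subgroup_graph_automorphisms:
  "subgroup (graph_automorphisms V E) (BijGroup V)"
proof (rule group.subgroupI[OF group_BijGroup])
  show "graph_automorphisms V E \<subseteq> carrier (BijGroup V)"
    by (auto simp: graph_automorphisms_def BijGroup_def)
  have "(\<lambda>x\<in>V. x) \<in> graph_automorphisms V E"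
    by (auto simp: graph_automorphisms_def id_Bij)
  then show "graph_automorphisms V E \<noteq> {}" by blast
next
  fix f assume f: "f \<in> graph_automorphisms V E"
  then have B: "f \<in> Bij V" by (simp add: graph_automorphisms_def)
  have bij: "bij_betw f V V" using B by (simp add: Bij_def)
  have inv: "inv\<^bsub>BijGroup V\<^esub> f = (\<lambda>x\<in>V. inv_into V f x)"
    using inv_BijGroup[OF B] .
  have "{inv_into V f x, inv_into V f y} \<in> E \<longleftrightarrow> {x, y} \<in> E" if "x \<in> V" "y \<in> V" for x y
  proof -
    have "inv_into V f x \<in> V" "inv_into V f y \<in> V"
      using bij that by (auto simp: bij_betw_def inv_into_into)
    then have "{f (inv_into V f x), f (inv_into V f y)} \<in> E
        \<longleftrightarrow> {inv_into V f x, inv_into V f y} \<in> E"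
      using f by (simp add: graph_automorphisms_def)
    then show ?thesis using bij that by (simp add: bij_betw_inv_into_right)
  qed
  then show "inv\<^bsub>BijGroup V\<^esub> f \<in> graph_automorphisms V E"
    unfolding inv using restrict_inv_into_Bij[OF B]
    by (simp add: graph_automorphisms_def)
next
  fix f g assume fg: "f \<in> graph_automorphisms V E" "g \<in> graph_automorphisms V E"
  then have B: "f \<in> Bij V" "g \<in> Bij V" by (auto simp: graph_automorphisms_def)
  have g: "g x \<in> V" if "x \<in> V" for x
    using B(2) that by (auto simp: Bij_def bij_betw_def)
  have m: "f \<otimes>\<^bsub>BijGroup V\<^esub> g = compose V f g"
    using B by (simp add: BijGroup_def)
  show "f \<otimes>\<^bsub>BijGroup V\<^esub> g \<in> graph_automorphisms V E"
    unfolding m using fg g compose_Bij[OF B]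
    by (simp add: graph_automorphisms_def compose_eq)
qed

lemma graph_action_Aut_graph: "graph_action V E (Aut_graph V E) (\<lambda>f. f)"
proof -
  have "group_action (Aut_graph V E) V (\<lambda>f. f)"
    unfolding group_action_def group_hom_def group_hom_axioms_def Aut_graph_def
    using subgroup.subgroup_is_group[OF subgroup_graph_automorphisms group_BijGroup]
    by (auto simp: hom_def group_BijGroup
        intro: subsetD[OF subgroup.subset[OF subgroup_graph_automorphisms]])
  then show ?thesis
    by (simp add: graph_action_def Aut_graph_def)
qed

end

theory Submission
  imports Defs
begin

text \<open>
  Repeatedly deleting all leaves shrinks the graph to its 2-core. The core is invariant under
  automorphisms, it contains all pivot vertices (a leaf has a neighbour fixed by its
  stabilizer), and the sum of \<open>deg v - 2\<close> over its vertices stays equal to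
  \<open>2 (\<beta> - 1)\<close>. A pivot vertex of core degree 2 has an automorphism exchanging its two neighbours,
  hence is the midpoint of the maximal chain of degree-2 vertices through it; so the two walks
  leaving it along the chain arrive at branch vertices through edge ends that belong to no other
  such pivot, and twice the number of pivots of degree 2 is at most the sum of the degrees of the
  branch vertices. A pivot vertex that is a branch vertex has even degree, so degree at least 4.
  Now compare with \<open>3 (deg v - 2)\<close> vertex by vertex.
\<close>

section \<open>Degrees, connectedness and excess relative to a vertex set\<close>

definition nb :: "'a set set \<Rightarrow> 'a set \<Rightarrow> 'a \<Rightarrow> 'a set" where
  "nb E W v = {w \<in> W. {v, w} \<in> E}"

text \<open>Connectedness of the subgraph induced on \<open>W\<close>, phrased by neighbour-closed
  sets instead of paths. This form survives leaf deletion easily, and it identifies \<open>W\<close>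
  as soon as a small closed set is found.\<close>

definition cut_connected :: "'a set set \<Rightarrow> 'a set \<Rightarrow> bool" where
  "cut_connected E W \<longleftrightarrow> (\<forall>S\<subseteq>W. S \<noteq> {} \<longrightarrow> (\<forall>x\<in>S. nb E W x \<subseteq> S) \<longrightarrow> S = W)"

text \<open>By double counting, twice the number of edges minus twice the number of vertices of the
  induced subgraph.\<close>

definition excess :: "'a set set \<Rightarrow> 'a set \<Rightarrow> int" where
  "excess E W = (\<Sum>v\<in>W. int (card (nb E W v)) - 2)"

text \<open>Always taken for automorphisms of the whole graph, even when neighbours are counted in a
  smaller \<open>W\<close>, because pivots are defined by the whole graph.\<close>

definition orb :: "'a set \<Rightarrow> 'a set set \<Rightarrow> 'a \<Rightarrow> 'a \<Rightarrow> 'a set" where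
  "orb V E v w = {g w | g. g \<in> graph_automorphisms V E \<and> g v = v}"

lemma pivot_vertex_iff:
  "pivot_vertex V E v \<longleftrightarrow> v \<in> V \<and> (\<forall>w\<in>nb E V v. even (card (orb V E v w)))"
  by (auto simp: pivot_vertex_def G_pivot_vertex_def orb_def nb_def stabilizer_def Aut_graph_def)

lemma mem_nb_commute: "v \<in> W \<Longrightarrow> w \<in> nb E W v \<Longrightarrow> v \<in> nb E W w"
  by (auto simp: nb_def insert_commute)

section \<open>Counting arcs of a finite graph\<close>

locale fin_graph =
  fixes V :: "'a set" and E :: "'a set set"
  assumes finite_graph: "finite_graph V E"
begin

abbreviation "N \<equiv> nb E"
abbreviation "\<A> \<equiv> graph_automorphisms V E"

text \<open>Oriented edges, equivalently edge ends: they turn degree sums into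
  cardinalities.\<close>

definition arcs :: "'a set \<Rightarrow> ('a \<times> 'a) set" where
  "arcs W = (SIGMA v:W. N W v)"

lemma finite_V: "finite V"
  using finite_graph by (simp add: finite_graph_def)

lemma edge_subset: "{x, y} \<in> E \<Longrightarrow> x \<in> V \<and> y \<in> V"
  using finite_graph by (auto simp: finite_graph_def)

lemma edge_neq: "{x, y} \<in> E \<Longrightarrow> x \<noteq> y"
proof
  assume "{x, y} \<in> E" "x = y"
  then have "card {x} = 2" using finite_graph by (force simp: finite_graph_def)
  then show False by simp
qed

lemma finite_nb: "W \<subseteq> V \<Longrightarrow> finite (N W v)"
  using finite_V by (auto simp: nb_def intro: finite_subset)

lemma nb_subset: "N W v \<subseteq> W"
  by (auto simp: nb_def)

lemma not_mem_nb_self: "v \<notin> N W v"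
  using edge_neq[of v v] by (auto simp: nb_def)

lemma finite_arcs: "W \<subseteq> V \<Longrightarrow> finite (arcs W)"
  unfolding arcs_def using finite_V finite_nb by (intro finite_SigmaI) (auto intro: finite_subset)

lemma card_arcs:
  assumes "W \<subseteq> V"
  shows "card (arcs W) = (\<Sum>v\<in>W. card (N W v))"
  unfolding arcs_def using assms finite_V finite_nb by (intro card_SigmaI) (auto intro: finite_subset)

lemma excess_eq:
  assumes "W \<subseteq> V"
  shows "excess E W = int (card (arcs W)) - 2 * int (card W)"
  using assms by (simp add: excess_def card_arcs sum_subtractf)

lemma cut_connected_V:
  assumes "connected_graph V E"
  shows "cut_connected E V"
  unfolding cut_connected_def
proof (intro allI impI)
  fix S assume S: "S \<subseteq> V" "S \<noteq> {}" "\<forall>x\<in>S. nb E V x \<subseteq> S"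
  then obtain s where s: "s \<in> S" by blast
  have "v \<in> S" if v: "v \<in> V" for v
  proof -
    have "(\<lambda>x y. {x, y} \<in> E)\<^sup>*\<^sup>* s v"
      using assms s S v by (auto simp: connected_graph_def)
    then show ?thesis
    proof (induction rule: rtranclp_induct)
      case base then show ?case using s by simp
    next
      case (step y z)
      then show ?case using S(3) edge_subset by (auto simp: nb_def)
    qed
  qed
  then show "S = V" using S by blast
qed

text \<open>Group the arcs by their underlying edge; its two distinct ends allow exactly two
  orientations.\<close>

lemma card_arcs_V: "card (arcs V) = 2 * card E"
proof -
  have finE: "finite E"
    using finite_graph by (auto simp: finite_graph_def intro: finite_subset[of E "Pow V"])
  have eq: "arcs V = (\<Union>e\<in>E. {(x, y). {x, y} = e})"
    using edge_subset by (auto simp: arcs_def nb_def)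
  have two: "finite {(x, y). {x, y} = e} \<and> card {(x, y). {x, y} = e} = 2" if e: "e \<in> E" for e
  proof -
    obtain a b where ab: "e = {a, b}" "a \<noteq> b"
      using finite_graph e by (auto simp: finite_graph_def card_2_iff)
    then have "{(x, y). {x, y} = e} = {(a, b), (b, a)}"
      by (auto simp: doubleton_eq_iff)
    then show ?thesis using ab by simp
  qed
  have "card (arcs V) = (\<Sum>e\<in>E. card {(x, y). {x, y} = e})"
    unfolding eq using finE two by (intro card_UN_disjoint) auto
  then show ?thesis using two by simp
qed

lemma excess_V: "excess E V = 2 * (betti V E - 1)"
  by (simp add: excess_eq card_arcs_V betti_def)

section \<open>Automorphisms and orbits of vertex stabilizers\<close>

lemma aut_edge: "g \<in> \<A> \<Longrightarrow> x \<in> V \<Longrightarrow> y \<in> V \<Longrightarrow> {g x, g y} \<in> E \<longleftrightarrow> {x, y} \<in> E"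
  by (simp add: graph_automorphisms_def)

lemma aut_bij: "g \<in> \<A> \<Longrightarrow> bij_betw g V V"
  by (simp add: graph_automorphisms_def Bij_def)

text \<open>Automorphisms are extensional functions on \<open>V\<close>, so identity, composite and
  inverse are recorded here and below only through their values on \<open>V\<close>, which is all
  that orbits see.\<close>

lemma aut_id: "\<exists>e\<in>\<A>. \<forall>x\<in>V. e x = x"
  by (rule bexI[of _ "\<lambda>x\<in>V. x"]) (auto simp: graph_automorphisms_def id_Bij)

lemma aut_comp:
  assumes "f \<in> \<A>" "g \<in> \<A>"
  shows "\<exists>h\<in>\<A>. \<forall>x\<in>V. h x = f (g x)"
proof -
  have "f \<in> Bij V" "g \<in> Bij V" using assms by (auto simp: graph_automorphisms_def)
  then have "compose V f g \<in> \<A>"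
    using subgroup.m_closed[OF subgroup_graph_automorphisms assms] by (simp add: BijGroup_def)
  then show ?thesis by (rule bexI[rotated]) (simp add: compose_eq)
qed

lemma aut_inv:
  assumes "g \<in> \<A>"
  shows "\<exists>h\<in>\<A>. \<forall>x\<in>V. h (g x) = x"
proof -
  have B: "g \<in> Bij V" using assms by (auto simp: graph_automorphisms_def)
  have "(\<lambda>x\<in>V. inv_into V g x) \<in> \<A>"
    using subgroup.m_inv_closed[OF subgroup_graph_automorphisms assms] inv_BijGroup[OF B] by simp
  moreover have "(\<lambda>x\<in>V. inv_into V g x) (g x) = x" if "x \<in> V" for x
    using aut_bij[OF assms] that by (auto simp: bij_betw_def)
  ultimately show ?thesis by blast
qed

lemma mem_orb_self: "v \<in> V \<Longrightarrow> w \<in> V \<Longrightarrow> w \<in> orb V E v w"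
  unfolding orb_def using aut_id by (metis (mono_tags, lifting) mem_Collect_eq)

lemma orb_subset_of_mem:
  assumes "v \<in> V" "w \<in> V" "u \<in> orb V E v w"
  shows "orb V E v u \<subseteq> orb V E v w"
proof
  fix x assume "x \<in> orb V E v u"
  then obtain f where f: "f \<in> \<A>" "f v = v" "x = f u" by (auto simp: orb_def)
  obtain g where g: "g \<in> \<A>" "g v = v" "u = g w" using assms by (auto simp: orb_def)
  obtain h where "h \<in> \<A>" "\<forall>x\<in>V. h x = f (g x)" using aut_comp[OF f(1) g(1)] by blast
  then show "x \<in> orb V E v w" unfolding orb_def using f g assms by (auto intro!: exI[of _ h])
qed

lemma orb_sym:
  assumes "v \<in> V" "w \<in> V" "u \<in> orb V E v w"
  shows "w \<in> orb V E v u"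
proof -
  obtain g where g: "g \<in> \<A>" "g v = v" "u = g w" using assms by (auto simp: orb_def)
  obtain h where h: "h \<in> \<A>" "\<forall>x\<in>V. h (g x) = x" using aut_inv[OF g(1)] by blast
  then have "h v = v" "h u = w" using g assms by metis+
  then show ?thesis using h by (auto simp: orb_def)
qed

lemma orb_subset_V: "w \<in> V \<Longrightarrow> orb V E v w \<subseteq> V"
  using aut_bij by (auto simp: orb_def bij_betw_def)

lemma orb_eq_of_meet:
  assumes "v \<in> V" "w \<in> V" "w' \<in> V" "x \<in> orb V E v w" "x \<in> orb V E v w'"
  shows "orb V E v w = orb V E v w'"
proof -
  have x: "x \<in> V" using assms orb_subset_V by blast
  have "orb V E v u = orb V E v x" if "u \<in> V" "x \<in> orb V E v u" for u
    using orb_subset_of_mem orb_sym assms(1) x that by (meson subset_antisym)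
  from this[of w] this[of w'] show ?thesis using assms by simp
qed

end

section \<open>Pivots in subgraphs invariant under automorphisms\<close>

locale invariant_subgraph = fin_graph +
  fixes W :: "'a set"
  assumes W_subset: "W \<subseteq> V"
    and invariant: "g \<in> \<A> \<Longrightarrow> x \<in> W \<Longrightarrow> g x \<in> W"
begin

abbreviation deg :: "'a \<Rightarrow> nat" where "deg v \<equiv> card (N W v)"

lemma finite_W: "finite W"
  using W_subset finite_V by (rule finite_subset)

lemma finite_N: "finite (N W v)"
  using W_subset by (rule finite_nb)

lemma nb_image:
  assumes g: "g \<in> \<A>" and v: "v \<in> W"
  shows "N W (g v) = g ` N W v"
proof -
  have inj: "inj_on g V" using aut_bij[OF g] by (simp add: bij_betw_def)
  then have "inj_on g W" using W_subset by (rule inj_on_subset)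
  \<comment> \<open>Invariance gives only an inclusion; injectivity on a finite set makes
    \<open>g\<close> a permutation of \<open>W\<close>.\<close>
  then have img: "g ` W = W" using invariant[OF g] finite_W by (intro endo_inj_surj) auto
  have "{g v, g w} \<in> E \<longleftrightarrow> {v, w} \<in> E" if "w \<in> W" for w
    using aut_edge[OF g] v that W_subset by blast
  then have "{w \<in> g ` W. {g v, w} \<in> E} = g ` {w \<in> W. {v, w} \<in> E}" by blast
  then show ?thesis using img by (simp add: nb_def)
qed

lemma deg_image:
  assumes "g \<in> \<A>" "v \<in> W"
  shows "deg (g v) = deg v"
proof -
  have "inj_on g (N W v)"
    using aut_bij[OF assms(1)] W_subset by (auto simp: bij_betw_def nb_def inj_on_def)
  then show ?thesis using nb_image[OF assms] by (simp add: card_image)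
qed

lemma orb_subset_nb:
  assumes "v \<in> W" "w \<in> N W v"
  shows "orb V E v w \<subseteq> N W v"
  using nb_image[OF _ assms(1)] assms(2) unfolding orb_def by force

lemma pivot_even_orb:
  "pivot_vertex V E v \<Longrightarrow> w \<in> N W v \<Longrightarrow> even (card (orb V E v w))"
  using W_subset by (auto simp: pivot_vertex_iff nb_def)

text \<open>The stabilizer of \<open>v\<close> acts on the neighbours inside \<open>W\<close>, which
  therefore split into disjoint orbits, each of even size.\<close>

lemma pivot_deg_even:
  assumes "pivot_vertex V E v" "v \<in> W"
  shows "even (deg v)"
proof -
  have v: "v \<in> V" using assms W_subset by blast
  have NV: "w \<in> V" if "w \<in> N W v" for w using that W_subset by (auto simp: nb_def)
  have eq: "N W v = \<Union> (orb V E v ` N W v)"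
    using orb_subset_nb[OF assms(2)] mem_orb_self[OF v] NV by blast
  have "2 dvd card (\<Union> (orb V E v ` N W v))"
  proof (rule dvd_partition)
    show "finite (\<Union> (orb V E v ` N W v))" using eq finite_N by metis
    show "\<forall>c\<in>orb V E v ` N W v. 2 dvd card c" using pivot_even_orb[OF assms(1)] by auto
    show "\<forall>c1\<in>orb V E v ` N W v. \<forall>c2\<in>orb V E v ` N W v. c1 \<noteq> c2 \<longrightarrow> c1 \<inter> c2 = {}"
      using orb_eq_of_meet[OF v] NV by blast
  qed
  then show ?thesis using eq by simp
qed

text \<open>The orbit of \<open>w\<close> lies in \<open>{w, z}\<close> and contains
  \<open>w\<close>; having even size, it must contain \<open>z\<close> too.\<close>

lemma pivot_swap:
  assumes piv: "pivot_vertex V E v" and v: "v \<in> W" and N: "N W v = {w, z}" "w \<noteq> z"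
  shows "\<exists>g\<in>\<A>. g v = v \<and> g w = z"
proof (rule ccontr)
  assume no: "\<not> ?thesis"
  have w: "w \<in> N W v" using N by simp
  have "orb V E v w \<subseteq> {w, z}" using orb_subset_nb[OF v w] N by simp
  moreover have "w \<in> orb V E v w" using mem_orb_self w v W_subset nb_subset by blast
  moreover have "z \<notin> orb V E v w" using no by (auto simp: orb_def)
  ultimately have "orb V E v w = {w}" by blast
  then show False using pivot_even_orb[OF piv w] by simp
qed

text \<open>This is what lets pivots survive the deletion of leaves.\<close>

lemma pivot_deg_neq_1:
  assumes "pivot_vertex V E v" "v \<in> W"
  shows "deg v \<noteq> 1"
  using pivot_deg_even[OF assms] by auto

end

section \<open>Pruning leaves down to the 2-core\<close>

locale connected_subgraph = invariant_subgraph +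
  assumes conn: "cut_connected E W"
    and excess_pos: "excess E W > 0"
    and pivot_mem: "pivot_vertex V E v \<Longrightarrow> v \<in> W"
begin

lemma closed_eq: "S \<subseteq> W \<Longrightarrow> S \<noteq> {} \<Longrightarrow> (\<And>x. x \<in> S \<Longrightarrow> N W x \<subseteq> S) \<Longrightarrow> S = W"
  using conn by (simp add: cut_connected_def)

text \<open>The bound \<open>deg v < 2\<close> makes absence of leaves the same as minimum degree 2,
  the condition at which pruning stops.\<close>

definition leaves :: "'a set" where "leaves = {v \<in> W. deg v < 2}"

text \<open>An isolated vertex would be a closed set, hence all of \<open>W\<close>, and the excess
  would be -2.\<close>

lemma deg_leaf:
  assumes v: "v \<in> leaves"
  shows "deg v = 1"
proof (rule ccontr)
  assume "deg v \<noteq> 1"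
  then have "deg v = 0" using v by (simp add: leaves_def)
  then have N: "N W v = {}" using finite_N by simp
  have "{v} = W" using v N by (intro closed_eq) (auto simp: leaves_def)
  then have "excess E W = -2" using N by (auto simp: excess_def)
  then show False using excess_pos by simp
qed

text \<open>Two adjacent leaves would form a closed set, so \<open>W\<close> would be a single edge
  with excess -2. Hence all leaves can be removed at once without interfering.\<close>

lemma nb_leaf:
  assumes v: "v \<in> leaves"
  obtains w where "N W v = {w}" "w \<in> W - leaves"
proof -
  obtain w where w: "N W v = {w}" using deg_leaf[OF v] by (auto simp: card_1_singleton_iff)
  have vW: "v \<in> W" using v by (simp add: leaves_def)
  have wW: "w \<in> W" using w nb_subset by blast
  have "w \<notin> leaves"
  proof
    assume wl: "w \<in> leaves"
    have "v \<in> N W w" using w vW by (auto intro: mem_nb_commute)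
    then have Nw: "N W w = {v}" using deg_leaf[OF wl] by (auto simp: card_1_singleton_iff)
    have W: "{v, w} = W" using vW wW w Nw by (intro closed_eq) auto
    have "v \<noteq> w" using w not_mem_nb_self by blast
    moreover have "excess E W = excess E {v, w}" using W by simp
    moreover have "N {v, w} v = {w}" "N {v, w} w = {v}" using w Nw W by auto
    ultimately have "excess E W = -2" by (simp add: excess_def)
    then show False using excess_pos by simp
  qed
  then show ?thesis using that w wW by blast
qed

lemma invariant_prune:
  assumes "g \<in> \<A>" "x \<in> W - leaves"
  shows "g x \<in> W - leaves"
  using assms invariant deg_image by (auto simp: leaves_def)

text \<open>A closed set of the pruned graph becomes closed in \<open>W\<close> after adding the
  leaves attached to it, since a leaf has no other neighbour.\<close>

lemma cut_connected_prune: "cut_connected E (W - leaves)"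
  unfolding cut_connected_def
proof (intro allI impI)
  fix S assume S: "S \<subseteq> W - leaves" "S \<noteq> {}" "\<forall>x\<in>S. N (W - leaves) x \<subseteq> S"
  have "S \<union> {l \<in> leaves. N W l \<subseteq> S} = W"
  proof (rule closed_eq)
    show "S \<union> {l \<in> leaves. N W l \<subseteq> S} \<subseteq> W" using S by (auto simp: leaves_def)
    show "S \<union> {l \<in> leaves. N W l \<subseteq> S} \<noteq> {}" using S by blast
    fix x assume x: "x \<in> S \<union> {l \<in> leaves. N W l \<subseteq> S}"
    show "N W x \<subseteq> S \<union> {l \<in> leaves. N W l \<subseteq> S}"
    proof (cases "x \<in> S")
      case True
      show ?thesis
      proof
        fix y assume y: "y \<in> N W x"
        show "y \<in> S \<union> {l \<in> leaves. N W l \<subseteq> S}"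
        proof (cases "y \<in> leaves")
          case yl: True
          have "x \<in> N W y" using y True S by (auto intro: mem_nb_commute)
          then have "N W y = {x}" using deg_leaf[OF yl] by (auto simp: card_1_singleton_iff)
          then show ?thesis using True yl by auto
        next
          case False
          then have "y \<in> N (W - leaves) x" using y by (auto simp: nb_def)
          then show ?thesis using S True by blast
        qed
      qed
    next
      case False
      then show ?thesis using x by blast
    qed
  qed
  then show "S = W - leaves" using S by blast
qed

text \<open>Each leaf takes away one vertex and two arcs, one leaving it and one entering it. As
  leaves are never adjacent, no arc is removed twice.\<close>

lemma excess_prune: "excess E (W - leaves) = excess E W"
proof -
  define A where "A = (SIGMA v:leaves. N W v)"
  have LW: "leaves \<subseteq> W" by (auto simp: leaves_def)
  have finL: "finite leaves" using LW finite_W by (rule finite_subset)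
  have cA: "card A = card leaves"
    unfolding A_def using finL finite_N deg_leaf by (subst card_SigmaI) auto
  have finA: "finite A" unfolding A_def using finL finite_N by blast
  have cA': "card (prod.swap ` A) = card leaves"
    using cA by (simp add: card_image)
  have dec: "arcs W = arcs (W - leaves) \<union> (A \<union> prod.swap ` A)"
  proof -
    have "(x, y) \<in> arcs W \<longleftrightarrow> (x, y) \<in> arcs (W - leaves) \<or> (x, y) \<in> A \<or> (y, x) \<in> A" for x y
      using LW by (auto simp: arcs_def A_def nb_def insert_commute)
    moreover have "(x, y) \<in> prod.swap ` A \<longleftrightarrow> (y, x) \<in> A" for x y
      by force
    ultimately show ?thesis by (auto simp del: pair_in_swap_image)
  qed
  have tip: "x \<in> leaves \<and> y \<notin> leaves" if "(x, y) \<in> A" for x y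
  proof -
    have x: "x \<in> leaves" and y: "y \<in> N W x" using that by (auto simp: A_def)
    obtain w where "N W x = {w}" "w \<in> W - leaves" using nb_leaf[OF x] .
    then show ?thesis using x y by simp
  qed
  have d1: "A \<inter> prod.swap ` A = {}"
  proof -
    have "(x, y) \<notin> prod.swap ` A" if "(x, y) \<in> A" for x y
      using tip[OF that] tip[of y x] by auto
    then show ?thesis by auto
  qed
  have d2: "arcs (W - leaves) \<inter> (A \<union> prod.swap ` A) = {}"
    by (auto simp: arcs_def A_def nb_def)
  have "W - leaves \<subseteq> V" using W_subset by blast
  then have fin': "finite (arcs (W - leaves))" by (rule finite_arcs)
  have "card (arcs W) = card (arcs (W - leaves)) + (card A + card (prod.swap ` A))"
    unfolding dec using d1 d2 finA fin' by (subst card_Un_disjoint) (auto simp: card_Un_disjoint)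
  moreover have "card W = card (W - leaves) + card leaves"
    using LW finite_W finL by (metis card_Diff_subset card_mono le_add_diff_inverse2)
  moreover have "W - leaves \<subseteq> V" using W_subset by blast
  ultimately show ?thesis using cA cA' W_subset by (simp add: excess_eq)
qed

lemma prune: "connected_subgraph V E (W - leaves)"
proof unfold_locales
  show "W - leaves \<subseteq> V" using W_subset by blast
  show "pivot_vertex V E v \<Longrightarrow> v \<in> W - leaves" for v
    using pivot_mem pivot_deg_neq_1 deg_leaf by blast
qed (simp_all add: invariant_prune cut_connected_prune excess_prune excess_pos del: Diff_iff)

end

lemma ex_core:
  assumes "connected_subgraph V E W"
  shows "\<exists>C. connected_subgraph V E C \<and> excess E C = excess E W \<and> (\<forall>v\<in>C. card (nb E C v) \<ge> 2)"
  using assms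
proof (induction "card W" arbitrary: W rule: less_induct)
  case less
  interpret connected_subgraph V E W by (rule less.prems)
  show ?case
  proof (cases "leaves = {}")
    case True
    then show ?thesis using less.prems by (auto simp: leaves_def not_less)
  next
    case False
    then have "card (W - leaves) < card W"
      using finite_W by (intro psubset_card_mono) (auto simp: leaves_def)
    from less.hyps[OF this prune] show ?thesis using excess_prune by simp
  qed
qed

section \<open>Walks along chains of degree-2 vertices\<close>

locale core = connected_subgraph +
  assumes deg_ge_2: "v \<in> W \<Longrightarrow> deg v \<ge> 2"
begin

text \<open>The walk along a chain of degree-2 vertices; \<open>step a\<close> is meaningful only if the head of the
  arc \<open>a\<close> has degree 2.\<close>

definition step :: "'a \<times> 'a \<Rightarrow> 'a \<times> 'a" where
  "step a = (snd a, THE z. N W (snd a) - {fst a} = {z})"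

lemma arcs_iff: "(x, y) \<in> arcs W \<longleftrightarrow> x \<in> W \<and> y \<in> W \<and> {x, y} \<in> E"
  by (auto simp: arcs_def nb_def)

lemma snd_arcs: "a \<in> arcs W \<Longrightarrow> snd a \<in> W"
  by (auto simp: arcs_def nb_def)

lemma swap_arcs: "a \<in> arcs W \<Longrightarrow> prod.swap a \<in> arcs W"
  by (cases a) (auto simp: arcs_iff insert_commute)

lemma step_eqI:
  assumes "N W y = {x, z}" "z \<noteq> x"
  shows "step (x, y) = (y, z)"
proof -
  have "N W y - {x} = {z}" using assms by auto
  then show ?thesis by (simp add: step_def)
qed

lemma stepE:
  assumes "(x, y) \<in> arcs W" "deg y = 2"
  obtains z where "step (x, y) = (y, z)" "N W y = {x, z}" "z \<noteq> x"
proof -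
  have "x \<in> N W y" using assms by (auto simp: arcs_iff nb_def insert_commute)
  then obtain z where "N W y = {x, z}" "z \<noteq> x"
    using assms(2) unfolding card_2_iff by (metis empty_iff insert_commute insert_iff)
  then show ?thesis using that step_eqI by blast
qed

lemma fst_step [simp]: "fst (step a) = snd a"
  by (simp add: step_def)

lemma step_arcs:
  assumes "a \<in> arcs W" "deg (snd a) = 2"
  shows "step a \<in> arcs W"
proof -
  obtain x y where a: "a = (x, y)" by (cases a)
  obtain z where z: "step (x, y) = (y, z)" "N W y = {x, z}" using assms a by (auto elim: stepE)
  have "y \<in> W" using assms a by (simp add: arcs_iff)
  then show ?thesis using a z by (auto simp: arcs_def)
qed

text \<open>Walks can be retraced: reversing arcs turns \<open>step\<close> into its inverse.
  Injectivity of \<open>step\<close> follows.\<close>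

lemma step_swap_step:
  assumes "a \<in> arcs W" "deg (snd a) = 2"
  shows "step (prod.swap (step a)) = prod.swap a"
proof -
  obtain x y where a: "a = (x, y)" by (cases a)
  obtain z where z: "step (x, y) = (y, z)" "N W y = {x, z}" "z \<noteq> x"
    using assms a by (auto elim: stepE)
  then have "step (z, y) = (y, x)" by (intro step_eqI) auto
  then show ?thesis using a z by simp
qed

lemma step_inj:
  assumes "a \<in> arcs W" "deg (snd a) = 2" "b \<in> arcs W" "deg (snd b) = 2" "step a = step b"
  shows "a = b"
  using step_swap_step[OF assms(1,2)] step_swap_step[OF assms(3,4)] assms(5) by (metis swap_swap)

lemma step_image:
  assumes g: "g \<in> \<A>" and a: "a \<in> arcs W" "deg (snd a) = 2"
  shows "step (map_prod g g a) = map_prod g g (step a)"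
proof -
  obtain x y where xy: "a = (x, y)" by (cases a)
  obtain z where z: "step (x, y) = (y, z)" "N W y = {x, z}" "z \<noteq> x"
    using a xy by (auto elim: stepE)
  have y: "x \<in> W" "y \<in> W" using a xy by (auto simp: arcs_iff)
  have zW: "z \<in> W" using z nb_subset by blast
  have "N W (g y) = {g x, g z}" using nb_image[OF g y(2)] z by simp
  moreover have "g z \<noteq> g x"
    using aut_bij[OF g] z(3) y zW W_subset by (metis bij_betw_def inj_on_contraD subsetD)
  ultimately have "step (g x, g y) = (g y, g z)" by (rule step_eqI)
  then show ?thesis using z xy by simp
qed

lemma image_arcs: "g \<in> \<A> \<Longrightarrow> a \<in> arcs W \<Longrightarrow> map_prod g g a \<in> arcs W"
  using aut_edge invariant W_subset by (cases a) (auto simp: arcs_iff subset_iff)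

text \<open>A walk that never meets a branch vertex has a finite orbit permuted by
  \<open>step\<close>. Its vertices form a closed set, so every vertex of \<open>W\<close> has
  degree 2 and the excess is 0, a contradiction.\<close>

lemma reaches_branch:
  assumes a: "a \<in> arcs W"
  shows "\<exists>n. deg (snd ((step ^^ n) a)) \<noteq> 2"
proof (rule ccontr)
  assume "\<not> ?thesis"
  then have d2: "deg (snd ((step ^^ n) a)) = 2" for n by simp
  have arc: "(step ^^ n) a \<in> arcs W" for n
    using a d2 by (induction n) (auto intro: step_arcs)
  define orbit where "orbit = range (\<lambda>n. (step ^^ n) a)"
  have sub: "step ` orbit \<subseteq> orbit"
  proof
    fix b assume "b \<in> step ` orbit"
    then obtain n where "b = step ((step ^^ n) a)" by (auto simp: orbit_def)
    then have "b = (step ^^ Suc n) a" by simp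
    then show "b \<in> orbit" unfolding orbit_def by blast
  qed
  have "finite orbit"
    using arc finite_arcs[OF W_subset] by (auto simp: orbit_def intro: finite_subset)
  moreover have "inj_on step orbit"
    using step_inj arc d2 by (auto simp: inj_on_def orbit_def)
  ultimately have surj: "step ` orbit = orbit" using sub by (simp add: endo_inj_surj)
  have "snd ` orbit = W"
  proof (rule closed_eq)
    show "snd ` orbit \<subseteq> W" unfolding orbit_def using arc snd_arcs by blast
    show "snd ` orbit \<noteq> {}" by (auto simp: orbit_def)
    fix y assume "y \<in> snd ` orbit"
    then obtain x where xy: "(x, y) \<in> orbit" by auto
    then obtain n where "(x, y) = (step ^^ n) a" by (auto simp: orbit_def)
    then have "(x, y) \<in> arcs W" "deg y = 2" using arc[of n] d2[of n] by (metis, metis snd_conv)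
    then obtain z where z: "step (x, y) = (y, z)" "N W y = {x, z}" by (auto elim: stepE)
    have "step (x, y) \<in> orbit" using xy sub by blast
    then have "z \<in> snd ` orbit" using z(1) by force
    \<comment> \<open>Surjectivity supplies a predecessor arc, whose head is the backward neighbour
      \<open>x\<close> of \<open>y\<close>.\<close>
    obtain b where b: "b \<in> orbit" "step b = (x, y)" using xy surj by (metis imageE)
    have "x \<in> snd ` orbit" using b fst_step[of b] by auto
    with \<open>z \<in> snd ` orbit\<close> show "N W y \<subseteq> snd ` orbit" using z(2) by simp
  qed
  moreover have "\<forall>v\<in>snd ` orbit. deg v = 2" using d2 unfolding orbit_def by blast
  ultimately have "\<forall>v\<in>W. deg v = 2" by (simp only:)
  then have "excess E W = 0" by (simp add: excess_def)
  then show False using excess_pos by simp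
qed

text \<open>Zero when the head of \<open>a\<close> is already a branch vertex; for arcs the minimum
  exists by \<open>reaches_branch\<close>.\<close>

definition time :: "'a \<times> 'a \<Rightarrow> nat" where
  "time a = (LEAST n. deg (snd ((step ^^ n) a)) \<noteq> 2)"

lemma time_step:
  assumes "a \<in> arcs W" "deg (snd a) = 2"
  shows "time a = Suc (time (step a))"
proof -
  obtain n where "deg (snd ((step ^^ n) a)) \<noteq> 2" using reaches_branch[OF assms(1)] by blast
  then have "time a = Suc (LEAST n. deg (snd ((step ^^ Suc n) a)) \<noteq> 2)"
    unfolding time_def using assms(2) by (intro Least_Suc) auto
  then show ?thesis by (simp add: time_def funpow_swap1)
qed

lemma time_pos_iff:
  assumes "a \<in> arcs W"
  shows "time a > 0 \<longleftrightarrow> deg (snd a) = 2"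
proof
  show "deg (snd a) = 2 \<Longrightarrow> time a > 0" using time_step[OF assms] by simp
  show "time a > 0 \<Longrightarrow> deg (snd a) = 2"
    using not_less_Least[of 0 "\<lambda>n. deg (snd ((step ^^ n) a)) \<noteq> 2"] by (simp add: time_def)
qed

text \<open>Automorphisms commute with \<open>step\<close> and preserve degrees, so they carry walks
  to walks of the same length.\<close>

lemma time_image:
  assumes g: "g \<in> \<A>" and a: "a \<in> arcs W"
  shows "time (map_prod g g a) = time a"
  using a
proof (induction "time a" arbitrary: a)
  case 0
  have "snd a \<in> W" using 0 by (simp add: snd_arcs)
  then show ?case
    using 0 time_pos_iff[OF 0(2)] time_pos_iff[OF image_arcs[OF g 0(2)]] deg_image[OF g, of "snd a"]
    by auto
next
  case (Suc n)
  have d: "deg (snd a) = 2" using Suc.hyps(2) time_pos_iff[OF Suc.prems] by simp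
  have "snd a \<in> W" using Suc.prems by (rule snd_arcs)
  then have d': "deg (snd (map_prod g g a)) = 2" using d deg_image[OF g] by simp
  have "n = time (step a)" using Suc.hyps(2) time_step[OF Suc.prems d] by simp
  from Suc.hyps(1)[OF this step_arcs[OF Suc.prems d]]
  show ?case
    using time_step[OF Suc.prems d] time_step[OF image_arcs[OF g Suc.prems] d']
      step_image[OF g Suc.prems d] by simp
qed

text \<open>For an arc \<open>a\<close> leaving a degree-2 vertex, \<open>step (prod.swap a)\<close> is the other arc leaving it.
  Advancing along the chain lengthens the walk in the opposite direction.\<close>

lemma walk_times:
  assumes "a \<in> arcs W" "deg (fst a) = 2" "k \<le> time a"
  shows "(step ^^ k) a \<in> arcs W \<and> deg (fst ((step ^^ k) a)) = 2 \<and> time ((step ^^ k) a) + k = time a \<and>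
    time (step (prod.swap ((step ^^ k) a))) = time (step (prod.swap a)) + k"
  using assms(3)
proof (induction k)
  case 0
  then show ?case using assms by simp
next
  case (Suc k)
  define b where "b = (step ^^ k) a"
  have b: "b \<in> arcs W" "deg (fst b) = 2" "time b + k = time a"
    "time (step (prod.swap b)) = time (step (prod.swap a)) + k"
    using Suc by (auto simp: b_def)
  have d: "deg (snd b) = 2" using b(3) Suc.prems time_pos_iff[OF b(1)] by simp
  \<comment> \<open>The opposite walk belonging to \<open>step b\<close> starts with
    \<open>prod.swap b\<close>, whose head \<open>fst b\<close> has degree 2; its next arc starts
    the opposite walk belonging to \<open>b\<close>.\<close>
  have "time (step (prod.swap (step b))) = Suc (time (step (prod.swap b)))"
    using step_swap_step[OF b(1) d] time_step[OF swap_arcs[OF b(1)]] b(2) by simp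
  then show ?case
    using step_arcs[OF b(1) d] d time_step[OF b(1) d] b by (simp flip: b_def)
qed

text \<open>The automorphism exchanging the two neighbours of the pivot carries one walk to the
  other. This is the midpoint property.\<close>

lemma pivot_time_opposite:
  assumes "pivot_vertex V E (fst a)" "deg (fst a) = 2" "a \<in> arcs W"
  shows "time (step (prod.swap a)) = time a"
proof -
  obtain v w where a: "a = (v, w)" by (cases a)
  have sw: "(w, v) \<in> arcs W" using swap_arcs[OF assms(3)] a by simp
  obtain z where z: "step (w, v) = (v, z)" "N W v = {w, z}" "z \<noteq> w"
    using stepE[OF sw] assms(2) a by auto
  have v: "v \<in> W" using sw by (simp add: arcs_iff)
  obtain g where g: "g \<in> \<A>" "g v = v" "g w = z"
    using pivot_swap[of v w z] assms(1) a v z by auto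
  then show ?thesis using time_image[OF g(1) assms(3)] a z by simp
qed

section \<open>Counting pivots by the edge ends where their walks arrive\<close>

definition arrival :: "'a \<times> 'a \<Rightarrow> 'a \<times> 'a" where
  "arrival a = (step ^^ time a) a"

text \<open>\<open>step\<close> is injective only on arcs whose head has degree 2; the bounds by
  \<open>time\<close> keep every cancelled step in that range.\<close>

lemma funpow_step_cancel:
  assumes "a \<in> arcs W" "deg (fst a) = 2" "b \<in> arcs W" "deg (fst b) = 2"
    and "m + k \<le> time a" "m \<le> time b" "(step ^^ (m + k)) a = (step ^^ m) b"
  shows "(step ^^ k) a = b"
  using assms(5-)
proof (induction m)
  case (Suc m)
  have *: "(step ^^ n) c \<in> arcs W \<and> deg (snd ((step ^^ n) c)) = 2"
    if "c \<in> arcs W" "deg (fst c) = 2" "Suc n \<le> time c" for n c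
    using walk_times[OF that(1,2), of n] that(3) time_pos_iff[of "(step ^^ n) c"] by auto
  have "step ((step ^^ (m + k)) a) = step ((step ^^ m) b)" using Suc.prems(3) by simp
  then have "(step ^^ (m + k)) a = (step ^^ m) b"
    using *[OF assms(1,2), of "m + k"] *[OF assms(3,4), of m] Suc.prems(1,2) step_inj by simp
  then show ?case using Suc.prems(1,2) by (intro Suc.IH) simp_all
qed simp

text \<open>Retracing from the common last arc shows that \<open>b\<close> lies \<open>k\<close>
  steps after \<open>a\<close>. Over these steps the forward time drops by \<open>k\<close> and the
  opposite time grows by \<open>k\<close>; both times agree at either pivot, so \<open>k\<close> is
  0.\<close>

lemma arrival_inj:
  assumes a: "pivot_vertex V E (fst a)" "deg (fst a) = 2" "a \<in> arcs W"
    and b: "pivot_vertex V E (fst b)" "deg (fst b) = 2" "b \<in> arcs W"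
    and eq: "arrival a = arrival b" and le: "time b \<le> time a"
  shows "a = b"
proof -
  obtain k where k: "time a = time b + k" using le le_iff_add by blast
  have ab: "(step ^^ k) a = b"
    using eq k by (intro funpow_step_cancel[OF a(3,2) b(3,2), of "time b"]) (simp_all add: arrival_def)
  have "time b = time a + k"
    using walk_times[OF a(3,2), of k] pivot_time_opposite[OF a] pivot_time_opposite[OF b] ab k by simp
  then show ?thesis using k ab by simp
qed

lemma card_deg_2_pivots:
  "2 * card {v \<in> W. pivot_vertex V E v \<and> deg v = 2} \<le> (\<Sum>v | v \<in> W \<and> deg v \<ge> 3. deg v)"
proof -
  define P where "P = {v \<in> W. pivot_vertex V E v \<and> deg v = 2}"
  define B where "B = {v \<in> W. deg v \<ge> 3}"
  have fin: "finite P" "finite B" using finite_W by (auto simp: P_def B_def)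
  have cA: "card (SIGMA v:P. N W v) = 2 * card P"
    using fin finite_N by (subst card_SigmaI) (auto simp: P_def)
  have cB: "card (SIGMA v:B. N W v) = (\<Sum>v\<in>B. deg v)"
    using fin finite_N by (intro card_SigmaI) auto
  have A: "pivot_vertex V E (fst a) \<and> deg (fst a) = 2 \<and> a \<in> arcs W" if "a \<in> (SIGMA v:P. N W v)" for a
    using that by (auto simp: P_def arcs_def)
  have "card (SIGMA v:P. N W v) \<le> card (SIGMA v:B. N W v)"
  proof (rule card_inj_on_le)
    \<comment> \<open>The swap turns the last arc, which enters a branch vertex, into an arc leaving
      it.\<close>
    show "inj_on (prod.swap \<circ> arrival) (SIGMA v:P. N W v)"
    proof (rule inj_onI)
      fix a b assume ab: "a \<in> (SIGMA v:P. N W v)" "b \<in> (SIGMA v:P. N W v)"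
        and "(prod.swap \<circ> arrival) a = (prod.swap \<circ> arrival) b"
      then have eq: "arrival a = arrival b" by (metis comp_apply swap_swap)
      show "a = b"
      proof (cases "time b \<le> time a")
        case True then show ?thesis using arrival_inj[OF _ _ _ _ _ _ eq] A[OF ab(1)] A[OF ab(2)] by blast
      next
        case False
        then have "time a \<le> time b" by simp
        then have "b = a" using arrival_inj[OF _ _ _ _ _ _ eq[symmetric]] A[OF ab(1)] A[OF ab(2)] by blast
        then show ?thesis by simp
      qed
    qed
    show "(prod.swap \<circ> arrival) ` (SIGMA v:P. N W v) \<subseteq> (SIGMA v:B. N W v)"
    proof (rule image_subsetI)
      fix a assume "a \<in> (SIGMA v:P. N W v)"
      note a = A[OF this]
      have arc: "arrival a \<in> arcs W" and "time (arrival a) = 0"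
        using walk_times[of a "time a"] a by (auto simp: arrival_def)
      then have "deg (snd (arrival a)) \<noteq> 2" using time_pos_iff[OF arc] by simp
      moreover have "snd (arrival a) \<in> W" using arc by (rule snd_arcs)
      \<comment> \<open>In the core, degree different from 2 means degree at least 3.\<close>
      ultimately have "snd (arrival a) \<in> B" using deg_ge_2[of "snd (arrival a)"] by (simp add: B_def)
      then show "(prod.swap \<circ> arrival) a \<in> (SIGMA v:B. N W v)"
        using swap_arcs[OF arc] by (cases "arrival a") (auto simp: arcs_def)
    qed
    show "finite (SIGMA v:B. N W v)" using fin finite_N by blast
  qed
  then show ?thesis using cA cB by (simp add: P_def B_def)
qed

text \<open>Weights: \<open>p\<close> counts pivots twice, \<open>q\<close> only those of degree 2,
  and \<open>r\<close> counts edge ends at branch vertices. Since \<open>q\<close> sums to at most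
  \<open>r\<close>, it suffices to bound \<open>p - q + r\<close> at each vertex.\<close>

lemma card_pivots: "2 * int (card {v \<in> V. pivot_vertex V E v}) \<le> 3 * excess E W"
proof -
  define p where "p v = (if pivot_vertex V E v then 2 else 0 :: int)" for v
  define q where "q v = (if pivot_vertex V E v \<and> deg v = 2 then 2 else 0 :: int)" for v
  define r where "r v = (if deg v \<ge> 3 then int (deg v) else 0)" for v
  have "{v \<in> V. pivot_vertex V E v} = {v \<in> W. pivot_vertex V E v}"
    using pivot_mem W_subset by blast
  then have sp: "2 * int (card {v \<in> V. pivot_vertex V E v}) = sum p W"
    using finite_W by (simp add: p_def flip: sum.inter_filter)
  have sq: "2 * int (card {v \<in> W. pivot_vertex V E v \<and> deg v = 2}) = sum q W"
    using finite_W by (simp add: q_def flip: sum.inter_filter)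
  have sr: "int (\<Sum>v | v \<in> W \<and> deg v \<ge> 3. deg v) = sum r W"
    using finite_W by (simp add: r_def flip: sum.inter_filter)
  have qr: "sum q W \<le> sum r W"
    using card_deg_2_pivots sq sr by linarith
  \<comment> \<open>At degree 2 both sides vanish. At a branch vertex of degree \<open>d\<close> the
    bound \<open>d \<le> 3 * (d - 2)\<close> needs \<open>d \<ge> 3\<close>, and with the extra 2 of
    a pivot it needs \<open>d \<ge> 4\<close>, which parity provides.\<close>
  have "p v - q v + r v \<le> 3 * (int (deg v) - 2)" if v: "v \<in> W" for v
  proof (cases "deg v = 2")
    case True
    then show ?thesis by (simp add: p_def q_def r_def)
  next
    case False
    then have d3: "deg v \<ge> 3" using deg_ge_2[OF v] by simp
    have "deg v \<ge> 4" if "pivot_vertex V E v"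
    proof -
      have "deg v \<noteq> 3" using pivot_deg_even[OF that v] by auto
      then show ?thesis using d3 by simp
    qed
    then show ?thesis using d3 by (auto simp: p_def q_def r_def)
  qed
  then have "(\<Sum>v\<in>W. p v - q v + r v) \<le> (\<Sum>v\<in>W. 3 * (int (deg v) - 2))"
    by (rule sum_mono)
  then have "sum p W - sum q W + sum r W \<le> 3 * excess E W"
    by (simp add: excess_def sum.distrib sum_subtractf flip: sum_distrib_left)
  then show ?thesis using sp qr by simp
qed

end

section \<open>The bound for the whole graph\<close>

theorem theorem3p7:
  fixes V :: "'a set" and E :: "'a set set"
  assumes "finite_graph V E"
    and "connected_graph V E"
    and "betti V E \<ge> 2"
  shows "int (card {v \<in> V. pivot_vertex V E v}) \<le> 3 * (betti V E - 1)"
proof -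
  interpret fin_graph V E using assms(1) by unfold_locales
  \<comment> \<open>Pruning starts from the full vertex set; Betti number at least 2 makes its
    excess positive.\<close>
  have "connected_subgraph V E V"
  proof unfold_locales
    show "g x \<in> V" if "g \<in> \<A>" "x \<in> V" for g x
      using aut_bij[OF that(1)] that(2) by (auto simp: bij_betw_def)
    show "excess E V > 0" using excess_V assms(3) by simp
  qed (use cut_connected_V[OF assms(2)] in \<open>auto simp: pivot_vertex_iff\<close>)
  then obtain C where C: "connected_subgraph V E C" "excess E C = excess E V"
    "\<forall>v\<in>C. card (N C v) \<ge> 2"
    using ex_core by blast
  interpret core V E C
    using C by (simp add: core_def core_axioms_def)
  show ?thesis using card_pivots C(2) excess_V by simp
qed

end
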